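(* Suppose that the data $y_t$ used in the surrogate 3DVar algorithm $$x_t^s = (I-KH)\,\mathcal{F}_s(x_{t-1}^s) + K y_t, \qquad t\ge 1, \qquad K = CH^{T}(HCH^{T}+R)^{-1},$$ is found from observing a true signal $x_t^{\mathrm{true}}$ given by $$x_t^{\mathrm{true}} = \mathcal{F}(x_{t-1}^{\mathrm{true}}), \qquad y_t = H x_t^{\mathrm{true}} + \gamma\,\eta_t, \qquad t\ge 1,$$ where the $\eta_t$ are i.i.d. and $\mathbb{E}\lVert\eta_t\rVert < A$ for some constant $A>0$ (the observations being noisy, potentially sparse, unbiased measurements of the true state). Suppose additionally that the Kalman gain matrix $K$ satisfies that, for some constant $\lambda\in(0,1)$, $$\lVert (I-KH)\,D\mathcal{F}(x)\rVert \le \lambda \quad \forall x\in\mathbb{R}^{d_x},$$ where $D\mathcal{F}$ denotes the Jacobian matrix of $\mathcal{F}$. Suppose further that $$\lVert (I-KH)(\mathcal{F}_s(x)-\mathcal{F}(x))\rVert \le \varepsilon \quad \forall x\in\mathbb{R}^{d_x}.$$ Then there exists a constant $c>0$ independent of $\gamma$, $\lambda$, and $\varepsilon$ such that the surrogate 3DVar algorithm satisfies $$\limsup_{t\to\infty}\ \mathbb{E}\lVert x_t^s - x_t^{\mathrm{true}}\rVert \le c\left(\frac{\gamma+\varepsilon}{1-\lambda}\right).$$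
   Context: $d_x$ and $d_y$ are the state and observation dimensions; states $x_t^{\mathrm{true}}, x_t^s$ lie in $\mathbb{R}^{d_x}$ and observations $y_t$ and noises $\eta_t$ in $\mathbb{R}^{d_y}$. $\mathcal{F}:\mathbb{R}^{d_x}\to\mathbb{R}^{d_x}$ is the true dynamics map governing the evolution of the state between observation times, and $\mathcal{F}_s:\mathbb{R}^{d_x}\to\mathbb{R}^{d_x}$ is a surrogate model for it. $H\in\mathbb{R}^{d_y\times d_x}$ is the linear observation operator, $C$ is the background error covariance, $R$ is the known measurement error covariance matrix, $K$ is the resulting time-independent Kalman gain matrix, and $I$ is the $d_x\times d_x$ identity matrix. The scalar $\gamma$ scales the observation noise. $x_t^s$ is the surrogate 3DVar filtering estimate of $x_t^{\mathrm{true}}$ at time $t$, started from an initialization $x_0^s$. $\lVert\cdot\rVert$ denotes a norm on vectors and the corresponding norm on matrices.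
   Formalization: The noise scale γ is assumed nonnegative (for γ < −ε the bound would be negative), and the initial error is assumed to have finite expectation, as it does for deterministic initial states; all estimates are assumed measurable so that the expectations make sense. *)

theory Defs
  imports "HOL-Probability.Probability"
begin

definition is_norm :: "('a::real_vector \<Rightarrow> real) \<Rightarrow> bool" where
  "is_norm N \<longleftrightarrow>
     (\<forall>x. N x = 0 \<longleftrightarrow> x = 0) \<and>
     (\<forall>a x. N (a *\<^sub>R x) = \<bar>a\<bar> * N x) \<and>
     (\<forall>x y. N (x + y) \<le> N x + N y)"

lemma is_norm_norm: "is_norm (norm :: 'a::real_normed_vector \<Rightarrow> real)"
  by (simp add: is_norm_def norm_triangle_ineq)

text \<open>
  The same formula as the library's \<^const>\<open>onorm\<close>, for an arbitrary norm \<open>N\<close> in place of the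
  Euclidean one. The quotient at \<open>0\<close> is \<open>0 / 0 = 0\<close> and does not affect the supremum. In finite
  dimension the quotients are bounded, so the real supremum is the genuine one.
\<close>

definition induced_norm :: "(real ^ 'n \<Rightarrow> real) \<Rightarrow> real ^ 'n ^ 'n \<Rightarrow> real" where
  "induced_norm N A = (SUP x. N (A *v x) / N x)"

lemma induced_norm_norm: "induced_norm norm A = onorm ((*v) A)"
  by (simp add: induced_norm_def onorm_def)

definition covariance_matrix :: "real ^ 'n ^ 'n \<Rightarrow> bool" where
  "covariance_matrix A \<longleftrightarrow> transpose A = A \<and> (\<forall>x. 0 \<le> x \<bullet> (A *v x))"

text \<open>
  \<^const>\<open>matrix_inv\<close> is only meaningful on invertible matrices, so users of the gain must assume
  that \<open>H ** C ** transpose H + R\<close> is invertible.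
\<close>

definition kalman_gain ::
    "real ^ 'dx ^ 'dx \<Rightarrow> real ^ 'dx ^ 'dy \<Rightarrow> real ^ 'dy ^ 'dy \<Rightarrow> real ^ 'dy ^ 'dx" where
  "kalman_gain C H R = C ** transpose H ** matrix_inv (H ** C ** transpose H + R)"

definition iid_from_1 ::
    "'w measure \<Rightarrow> (nat \<Rightarrow> 'w \<Rightarrow> 'a::euclidean_space) \<Rightarrow> bool" where
  "iid_from_1 M X \<longleftrightarrow>
     prob_space.indep_vars M (\<lambda>_. borel) X {1..} \<and>
     (\<forall>t\<ge>1. distr M borel (X t) = distr M borel (X 1))"

definition true_signal ::
    "'w measure \<Rightarrow> ('a \<Rightarrow> 'a) \<Rightarrow> (nat \<Rightarrow> 'w \<Rightarrow> 'a) \<Rightarrow> bool" where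
  "true_signal M F x \<longleftrightarrow> (\<forall>t\<ge>1. \<forall>\<omega>\<in>space M. x t \<omega> = F (x (t - 1) \<omega>))"

definition observations ::
    "'w measure \<Rightarrow> real ^ 'dx ^ 'dy \<Rightarrow> real \<Rightarrow> (nat \<Rightarrow> 'w \<Rightarrow> real ^ 'dy) \<Rightarrow>
      (nat \<Rightarrow> 'w \<Rightarrow> real ^ 'dx) \<Rightarrow> (nat \<Rightarrow> 'w \<Rightarrow> real ^ 'dy) \<Rightarrow> bool" where
  "observations M H \<gamma> \<eta> x y \<longleftrightarrow>
     (\<forall>t\<ge>1. \<forall>\<omega>\<in>space M. y t \<omega> = H *v x t \<omega> + \<gamma> *\<^sub>R \<eta> t \<omega>)"

definition surrogate_3dvar ::
    "'w measure \<Rightarrow> real ^ 'dx ^ 'dy \<Rightarrow> real ^ 'dy ^ 'dx \<Rightarrow> (real ^ 'dx \<Rightarrow> real ^ 'dx) \<Rightarrow>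
      (nat \<Rightarrow> 'w \<Rightarrow> real ^ 'dy) \<Rightarrow> (nat \<Rightarrow> 'w \<Rightarrow> real ^ 'dx) \<Rightarrow> bool" where
  "surrogate_3dvar M H K Fs y xs \<longleftrightarrow>
     (\<forall>t\<ge>1. \<forall>\<omega>\<in>space M.
        xs t \<omega> = (mat 1 - K ** H) *v Fs (xs (t - 1) \<omega>) + K *v y t \<omega>)"

end

theory Submission
  imports Defs
begin

text \<open>
  Since \<open>x\<^sub>t = (I - K H) F(x\<^sub>t\<^sub>-\<^sub>1) + K H x\<^sub>t\<close> for the true signal, the error \<open>e\<^sub>t\<close> of the
  surrogate estimate \<open>s\<^sub>t\<close> is the sum of \<open>(I - K H) (Fs(s\<^sub>t\<^sub>-\<^sub>1) - F(s\<^sub>t\<^sub>-\<^sub>1))\<close>, of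
  \<open>(I - K H) (F(s\<^sub>t\<^sub>-\<^sub>1) - F(x\<^sub>t\<^sub>-\<^sub>1))\<close> and of \<open>\<gamma> K \<eta>\<^sub>t\<close>.  The mean value inequality
  bounds the second term by \<open>\<lambda> \<parallel>e\<^sub>t\<^sub>-\<^sub>1\<parallel>\<close>, so the expected error satisfies
  \<open>a\<^sub>t \<le> \<lambda> a\<^sub>t\<^sub>-\<^sub>1 + \<epsilon> + \<gamma> L A\<close>, where \<open>L\<close> is an operator norm of \<open>K\<close>; unrolling this
  gives the bound with \<open>c = max 1 (L A)\<close>.
\<close>

section \<open>Elementary properties of an abstract norm\<close>

lemma is_norm_zero_iff: "is_norm N \<Longrightarrow> N x = 0 \<longleftrightarrow> x = 0"
  and is_norm_scaleR: "is_norm N \<Longrightarrow> N (a *\<^sub>R x) = \<bar>a\<bar> * N x"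
  and is_norm_triangle: "is_norm N \<Longrightarrow> N (x + y) \<le> N x + N y"
  by (auto simp: is_norm_def)

lemma is_norm_nonneg:
  assumes "is_norm N"
  shows "0 \<le> N x"
proof -
  have "N (x + (-1) *\<^sub>R x) \<le> N x + N ((-1) *\<^sub>R x)"
    by (rule is_norm_triangle[OF assms])
  moreover have "N ((-1) *\<^sub>R x) = N x"
    by (subst is_norm_scaleR[OF assms]) simp
  ultimately show ?thesis
    using is_norm_zero_iff[OF assms, of 0] by simp
qed

lemma convex_on_is_norm:
  assumes "is_norm N"
  shows "convex_on UNIV N"
proof (rule convex_onI)
  fix t :: real and x y
  assume "0 < t" "t < 1"
  then show "N ((1 - t) *\<^sub>R x + t *\<^sub>R y) \<le> (1 - t) * N x + t * N y"
    using is_norm_triangle[OF assms, of "(1 - t) *\<^sub>R x" "t *\<^sub>R y"]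
    by (simp add: is_norm_scaleR[OF assms])
qed simp

text \<open>A finite convex function on a whole Euclidean space is continuous, which replaces any
  comparison of \<open>N\<close> with the Euclidean norm. Measurability of \<open>N\<close> and the
  compactness argument below rest on this.\<close>

lemma continuous_on_is_norm:
  fixes N :: "'a::euclidean_space \<Rightarrow> real"
  assumes "is_norm N"
  shows "continuous_on S N"
  using convex_on_continuous[OF open_UNIV convex_on_is_norm[OF assms]]
  by (rule continuous_on_subset) simp

lemma borel_measurable_is_norm:
  fixes N :: "'a::euclidean_space \<Rightarrow> real"
  assumes "is_norm N"
  shows "N \<in> borel_measurable borel"
  by (rule borel_measurable_continuous_onI[OF continuous_on_is_norm[OF assms]])

section \<open>Operator bounds in finite dimension\<close>

text \<open>On the compact Euclidean unit sphere \<open>P\<close> has no zero, so the quotient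
  \<open>N (f v) / P v\<close> is continuous and hence bounded there; homogeneity extends the bound
  to every \<open>v\<close>. With two different norms it yields the constant for the gain
  \<open>K\<close>, with equal ones the finiteness of \<open>induced_norm\<close>.\<close>

lemma linear_is_norm_bounded:
  fixes f :: "'a::euclidean_space \<Rightarrow> 'b::euclidean_space"
  assumes "linear f" and N: "is_norm N" and P: "is_norm P"
  obtains L where "L > 0" and "\<And>v. N (f v) \<le> L * P v"
proof -
  let ?S = "sphere (0::'a) 1"
  let ?q = "\<lambda>v. N (f v) / P v"
  have nz: "P v \<noteq> 0" if "v \<in> ?S" for v
    using that is_norm_zero_iff[OF P, of v] by auto
  have "continuous_on ?S (\<lambda>v. N (f v))"
    by (rule continuous_on_compose2[OF continuous_on_is_norm[OF N, of UNIV]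
          linear_continuous_on[OF linear_conv_bounded_linear[THEN iffD1, OF assms(1)]]]) simp
  then have "continuous_on ?S ?q"
    by (intro continuous_on_divide continuous_on_is_norm[OF P] ballI nz)
  then have "bounded (?q ` ?S)"
    by (intro compact_imp_bounded compact_continuous_image compact_sphere)
  then obtain b where b: "b > 0" "\<And>v. v \<in> ?S \<Longrightarrow> \<bar>?q v\<bar> \<le> b"
    by (auto simp: bounded_pos)
  have "N (f v) \<le> b * P v" for v
  proof (cases "v = 0")
    case True
    then show ?thesis
      using is_norm_zero_iff[OF N, of 0] is_norm_zero_iff[OF P, of 0] linear_0[OF assms(1)] by simp
  next
    case False
    define u where "u = (1 / norm v) *\<^sub>R v"
    have u: "u \<in> ?S" and v: "v = norm v *\<^sub>R u"
      using False by (simp_all add: u_def)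
    have "P u > 0"
      using nz[OF u] is_norm_nonneg[OF P, of u] by simp
    then have "N (f u) \<le> b * P u"
      using b(2)[OF u] by (simp add: divide_le_eq abs_le_iff)
    then have "norm v * N (f u) \<le> norm v * (b * P u)"
      by (rule mult_left_mono) simp
    moreover have "N (f v) = norm v * N (f u)"
      by (subst v) (simp add: linear_scale[OF assms(1)] is_norm_scaleR[OF N])
    moreover have "P v = norm v * P u"
      by (subst v) (simp add: is_norm_scaleR[OF P])
    ultimately show ?thesis
      by (simp add: mult_ac)
  qed
  with b(1) show thesis
    by (rule that)
qed

text \<open>The point is that the quotients are bounded above: only then does the real supremum in
  \<open>induced_norm\<close> dominate each of them.\<close>

lemma is_norm_matrix_vector_mult_le:
  assumes N: "is_norm N"
  shows "N (B *v x) \<le> induced_norm N B * N x"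
proof (cases "x = 0")
  case True
  then show ?thesis
    using is_norm_zero_iff[OF N, of 0] by simp
next
  case False
  then have pos: "N x > 0"
    using is_norm_nonneg[OF N, of x] is_norm_zero_iff[OF N, of x] by simp
  obtain L where L: "L > 0" "\<And>v. N (B *v v) \<le> L * N v"
    using linear_is_norm_bounded[OF matrix_vector_mul_linear N N] by blast
  \<comment> \<open>At \<open>N v = 0\<close> the quotient is \<open>0\<close> by the convention for
    division, and \<open>L > 0\<close> covers it.\<close>
  have "N (B *v v) / N v \<le> L" for v
    using L is_norm_nonneg[OF N, of v] by (cases "N v = 0") (auto simp: divide_le_eq)
  then have "bdd_above (range (\<lambda>x. N (B *v x) / N x))"
    by (auto intro!: bdd_aboveI[of _ L])
  then have "N (B *v x) / N x \<le> induced_norm N B"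
    unfolding induced_norm_def by (rule cSUP_upper[OF UNIV_I])
  then show ?thesis
    using pos by (simp add: divide_le_eq)
qed

section \<open>Mean value inequality for an arbitrary norm\<close>

text \<open>
  The closed \<open>N\<close>-ball of radius \<open>k\<close> is an intersection of half-spaces, and on each of
  them the scalar mean value theorem applies; this avoids duality for the norm \<open>N\<close>.
\<close>

lemma is_norm_mean_value:
  fixes g :: "'a::euclidean_space \<Rightarrow> 'b::euclidean_space"
  assumes N: "is_norm N"
    and deriv: "\<And>z. (g has_derivative g' z) (at z)"
    and bound: "\<And>z. N (g' z (y - x)) \<le> k"
  shows "N (g y - g x) \<le> k"
proof (rule ccontr)
  assume neg: "\<not> ?thesis"
  define S where "S = {v. N v \<le> k}"
  have "convex S"
    unfolding convex_alt
  proof (intro ballI allI impI)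
    fix v w u assume vw: "v \<in> S" "w \<in> S" and u: "0 \<le> (u::real) \<and> u \<le> 1"
    have "N ((1 - u) *\<^sub>R v + u *\<^sub>R w) \<le> (1 - u) * N v + u * N w"
      using u is_norm_triangle[OF N, of "(1 - u) *\<^sub>R v" "u *\<^sub>R w"]
      by (simp add: is_norm_scaleR[OF N])
    also have "\<dots> \<le> k"
      using vw u by (intro convex_bound_le) (auto simp: S_def)
    finally show "(1 - u) *\<^sub>R v + u *\<^sub>R w \<in> S"
      by (simp add: S_def)
  qed
  moreover have "closed S"
    unfolding S_def by (intro closed_Collect_le continuous_on_is_norm[OF N] continuous_on_const)
  \<comment> \<open>If the increment lay outside the ball, a hyperplane would strictly separate it
    from the ball; \<open>a\<close> is its normal.\<close>
  ultimately obtain a b where ab: "a \<bullet> (g y - g x) < b" "\<And>v. v \<in> S \<Longrightarrow> b < a \<bullet> v"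
    using separating_hyperplane_closed_point[of S "g y - g x"] neg by (auto simp: S_def)
  define p where "p s = x + s *\<^sub>R (y - x)" for s :: real
  have "((\<lambda>s. a \<bullet> g (p s)) has_derivative (\<lambda>h. a \<bullet> g' (p s) (h *\<^sub>R (y - x)))) (at s)" for s
  proof -
    have "(p has_derivative (\<lambda>h. h *\<^sub>R (y - x))) (at s)"
      unfolding p_def by (auto intro!: derivative_eq_intros)
    then show ?thesis
      by (intro has_derivative_inner_right has_derivative_compose[OF _ deriv])
  qed
  \<comment> \<open>The scalar function is \<open>a \<bullet> g\<close> along the segment from
    \<open>x\<close> to \<open>y\<close>, so its increment is attained by a derivative. That
    derivative's vector lies in the ball, on the other side of the hyperplane.\<close>
  then obtain s where "a \<bullet> g (p 1) - a \<bullet> g (p 0) = a \<bullet> g' (p s) ((1 - 0) *\<^sub>R (y - x))"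
    using mvt_simple[of 0 1 "\<lambda>s. a \<bullet> g (p s)" "\<lambda>s h. a \<bullet> g' (p s) (h *\<^sub>R (y - x))"]
    by (auto intro: has_derivative_at_withinI)
  then have "a \<bullet> (g y - g x) = a \<bullet> g' (p s) (y - x)"
    by (simp add: p_def inner_diff_right)
  moreover have "g' (p s) (y - x) \<in> S"
    using bound by (simp add: S_def)
  ultimately show False
    using ab by fastforce
qed

section \<open>Limit superior of a contractive recurrence\<close>

text \<open>\<open>B / (1 - q)\<close> is the fixed point of \<open>s \<mapsto> q * s + B\<close>,
  and the excess over it decays like \<open>q ^ t\<close>. With values in \<open>ennreal\<close>,
  finiteness is asked only at time \<open>0\<close> and propagates.\<close>

lemma contraction_recurrence_limsup_le:
  fixes a :: "nat \<Rightarrow> ennreal" and q B :: real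
  assumes q: "0 \<le> q" "q < 1" and B: "0 \<le> B" and fin: "a 0 < \<infinity>"
    and step: "\<And>t. a (Suc t) \<le> ennreal q * a t + ennreal B"
  shows "limsup a \<le> ennreal (B / (1 - q))"
proof -
  obtain r where r: "0 \<le> r" "a 0 = ennreal r"
    using fin by (cases "a 0") auto
  have bound: "a t \<le> ennreal (q ^ t * r + B / (1 - q))" for t
  proof (induction t)
    case 0
    then show ?case
      using r q B by (auto intro!: ennreal_leI)
  next
    case (Suc t)
    have "a (Suc t) \<le> ennreal q * ennreal (q ^ t * r + B / (1 - q)) + ennreal B"
      using step[of t] Suc by (meson add_right_mono mult_left_mono order_trans zero_le)
    also have "\<dots> = ennreal (q * (q ^ t * r + B / (1 - q)) + B)"
      using q B r by (simp add: ennreal_mult ennreal_plus)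
    also have "q * (q ^ t * r + B / (1 - q)) + B = q ^ Suc t * r + B / (1 - q)"
      using q by (simp add: field_simps)
    finally show ?case .
  qed
  have "(\<lambda>t. q ^ t * r + B / (1 - q)) \<longlonglongrightarrow> 0 * r + B / (1 - q)"
    using q by (intro tendsto_intros LIMSEQ_power_zero) auto
  then have "(\<lambda>t. ennreal (q ^ t * r + B / (1 - q))) \<longlonglongrightarrow> ennreal (B / (1 - q))"
    by (intro tendsto_ennrealI) simp
  then have "limsup (\<lambda>t. ennreal (q ^ t * r + B / (1 - q))) = ennreal (B / (1 - q))"
    by (intro lim_imp_Limsup) auto
  moreover have "limsup a \<le> limsup (\<lambda>t. ennreal (q ^ t * r + B / (1 - q)))"
    by (intro Limsup_mono always_eventually allI bound)
  ultimately show ?thesis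
    by simp
qed

section \<open>Error bound for surrogate 3DVar\<close>

theorem theorem1:
  fixes H :: "real ^ 'dx ^ 'dy"
    and C :: "real ^ 'dx ^ 'dx"
    and R :: "real ^ 'dy ^ 'dy"
    and K :: "real ^ 'dy ^ 'dx"
    and Nx :: "real ^ 'dx \<Rightarrow> real"
    and Ny :: "real ^ 'dy \<Rightarrow> real"
    and A :: real
  assumes "is_norm Nx" and "is_norm Ny"
    and "covariance_matrix C" and "covariance_matrix R"
    and "invertible (H ** C ** transpose H + R)"
    and "K = kalman_gain C H R"
    and "A > 0"
  shows "\<exists>c>0. \<forall>(\<gamma>::real) (lam::real) (\<epsilon>::real)
      (F :: real ^ 'dx \<Rightarrow> real ^ 'dx) (Fs :: real ^ 'dx \<Rightarrow> real ^ 'dx)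
      (M :: 'w measure) (\<eta> :: nat \<Rightarrow> 'w \<Rightarrow> real ^ 'dy)
      (xtrue :: nat \<Rightarrow> 'w \<Rightarrow> real ^ 'dx) (y :: nat \<Rightarrow> 'w \<Rightarrow> real ^ 'dy)
      (xs :: nat \<Rightarrow> 'w \<Rightarrow> real ^ 'dx).
      \<gamma> \<ge> 0 \<longrightarrow> 0 < lam \<longrightarrow> lam < 1 \<longrightarrow>
      prob_space M \<longrightarrow>
      iid_from_1 M \<eta> \<longrightarrow>
      (\<forall>t\<ge>1. (\<integral>\<^sup>+\<omega>. ennreal (Ny (\<eta> t \<omega>)) \<partial>M) < ennreal A) \<longrightarrow>
      (\<forall>t\<ge>1. (\<integral>\<omega>. \<eta> t \<omega> \<partial>M) = 0) \<longrightarrow>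
      true_signal M F xtrue \<longrightarrow>
      observations M H \<gamma> \<eta> xtrue y \<longrightarrow>
      surrogate_3dvar M H K Fs y xs \<longrightarrow>
      xtrue 0 \<in> borel_measurable M \<longrightarrow>
      (\<forall>t. xs t \<in> borel_measurable M) \<longrightarrow>
      (\<integral>\<^sup>+\<omega>. ennreal (Nx (xs 0 \<omega> - xtrue 0 \<omega>)) \<partial>M) < \<infinity> \<longrightarrow>
      (\<forall>x. F differentiable (at x)) \<longrightarrow>
      (\<forall>x. induced_norm Nx ((mat 1 - K ** H) ** jacobian F (at x)) \<le> lam) \<longrightarrow>
      (\<forall>x. Nx ((mat 1 - K ** H) *v (Fs x - F x)) \<le> \<epsilon>) \<longrightarrow>
      limsup (\<lambda>t. \<integral>\<^sup>+\<omega>. ennreal (Nx (xs t \<omega> - xtrue t \<omega>)) \<partial>M)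
        \<le> ennreal (c * ((\<gamma> + \<epsilon>) / (1 - lam)))"
proof -
  let ?W = "mat 1 - K ** H"
  \<comment> \<open>\<open>L\<close> depends only on \<open>K\<close> and the two norms. Fixing it
    before \<open>\<gamma>\<close>, \<open>lam\<close> and \<open>\<epsilon>\<close> are introduced
    makes \<open>c\<close> independent of them.\<close>
  obtain L where L: "L > 0" "\<And>v. Nx (K *v v) \<le> L * Ny v"
    using linear_is_norm_bounded[OF matrix_vector_mul_linear[of K] assms(1,2)] by blast
  define c where "c = max 1 (L * A)"
  have "c > 0"
    by (simp add: c_def)
  moreover have "limsup (\<lambda>t. \<integral>\<^sup>+\<omega>. ennreal (Nx (xs t \<omega> - xtrue t \<omega>)) \<partial>M)
        \<le> ennreal (c * ((\<gamma> + \<epsilon>) / (1 - lam)))"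
    if \<gamma>: "\<gamma> \<ge> 0" and lam: "0 < lam" "lam < 1"
      and prob: "prob_space M"
      and iid: "iid_from_1 M \<eta>"
      and noise: "\<forall>t\<ge>1. (\<integral>\<^sup>+\<omega>. ennreal (Ny (\<eta> t \<omega>)) \<partial>M) < ennreal A"
      and signal: "true_signal M F xtrue"
      and obs: "observations M H \<gamma> \<eta> xtrue y"
      and alg: "surrogate_3dvar M H K Fs y xs"
      and meas0: "xtrue 0 \<in> borel_measurable M"
      and meas_xs: "\<forall>t. xs t \<in> borel_measurable M"
      and fin: "(\<integral>\<^sup>+\<omega>. ennreal (Nx (xs 0 \<omega> - xtrue 0 \<omega>)) \<partial>M) < \<infinity>"
      and diff: "\<forall>x. F differentiable (at x)"
      and contr: "\<forall>x. induced_norm Nx (?W ** jacobian F (at x)) \<le> lam"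
      and surr: "\<forall>x. Nx (?W *v (Fs x - F x)) \<le> \<epsilon>"
    for \<gamma> lam \<epsilon> :: real and F Fs :: "real ^ 'dx \<Rightarrow> real ^ 'dx" and M :: "'w measure"
      and \<eta> y :: "nat \<Rightarrow> 'w \<Rightarrow> real ^ 'dy" and xtrue xs :: "nat \<Rightarrow> 'w \<Rightarrow> real ^ 'dx"
  proof -
    interpret prob_space M by (rule prob)
    \<comment> \<open>The surrogate hypothesis at any point bounds a norm value by
      \<open>\<epsilon>\<close>.\<close>
    have \<epsilon>: "\<epsilon> \<ge> 0"
      using order_trans[OF is_norm_nonneg[OF assms(1)] surr[rule_format]] .
    have meas_F: "F \<in> borel_measurable borel"
      using diff differentiable_imp_continuous_within
      by (intro borel_measurable_continuous_onI continuous_at_imp_continuous_on) blast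
    \<comment> \<open>Differentiability makes \<open>F\<close> continuous, hence Borel, so
      measurability passes from \<open>xtrue 0\<close> to later times. For \<open>Fs\<close> no
      regularity is assumed, so measurability of \<open>xs\<close> is a hypothesis.\<close>
    have meas_x: "xtrue t \<in> borel_measurable M" for t
    proof (induction t)
      case (Suc t)
      have "(\<lambda>\<omega>. F (xtrue t \<omega>)) \<in> borel_measurable M"
        using meas_F Suc by (rule measurable_compose_rev)
      then show ?case
        using signal by (subst measurable_cong) (auto simp: true_signal_def)
    qed (rule meas0)
    \<comment> \<open>Independence over \<open>{1..}\<close> includes measurability of each member;
      the index \<open>Suc t\<close> stays in that range.\<close>
    have meas_\<eta>: "\<eta> (Suc t) \<in> borel_measurable M" for t
      using iid by (auto simp: iid_from_1_def indep_vars_def)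
    define E where "E t \<omega> = Nx (xs t \<omega> - xtrue t \<omega>)" for t \<omega>
    have meas_E: "E t \<in> borel_measurable M" for t
      unfolding E_def using meas_x meas_xs
      by (intro measurable_compose[OF _ borel_measurable_is_norm[OF assms(1)]] borel_measurable_diff) auto
    have meas_N: "(\<lambda>\<omega>. Ny (\<eta> (Suc t) \<omega>)) \<in> borel_measurable M" for t
      by (intro measurable_compose[OF meas_\<eta> borel_measurable_is_norm[OF assms(2)]])
    \<comment> \<open>The increment \<open>u - v\<close> is fixed, so the contraction hypothesis
      bounds the derivative of \<open>?W *v F w\<close> in this direction by one constant at all
      points.\<close>
    have lip: "Nx (?W *v F u - ?W *v F v) \<le> lam * Nx (u - v)" for u v
    proof (rule is_norm_mean_value[OF assms(1), where g = "\<lambda>w. ?W *v F w" and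
          g' = "\<lambda>z h. ?W *v (jacobian F (at z) *v h)"])
      fix z
      have "(F has_derivative (\<lambda>h. jacobian F (at z) *v h)) (at z)"
        using diff jacobian_works by blast
      then show "((\<lambda>w. ?W *v F w) has_derivative (\<lambda>h. ?W *v (jacobian F (at z) *v h))) (at z)"
        by (rule bounded_linear.has_derivative[OF matrix_vector_mul_bounded_linear])
      show "Nx (?W *v (jacobian F (at z) *v (u - v))) \<le> lam * Nx (u - v)"
        using is_norm_matrix_vector_mult_le[OF assms(1), of "?W ** jacobian F (at z)" "u - v"]
          mult_right_mono[OF contr[rule_format, of z] is_norm_nonneg[OF assms(1), of "u - v"]]
        by (simp add: matrix_vector_mul_assoc)
    qed
    have step: "E (Suc t) \<omega> \<le> lam * E t \<omega> + \<epsilon> + \<gamma> * L * Ny (\<eta> (Suc t) \<omega>)"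
      if \<omega>: "\<omega> \<in> space M" for t \<omega>
    proof -
      have x: "xtrue (Suc t) \<omega> = F (xtrue t \<omega>)"
        using signal \<omega> by (simp add: true_signal_def)
      have "xs (Suc t) \<omega> = ?W *v Fs (xs t \<omega>) + K *v (H *v xtrue (Suc t) \<omega> + \<gamma> *\<^sub>R \<eta> (Suc t) \<omega>)"
        using alg obs \<omega> by (simp add: surrogate_3dvar_def observations_def)
      then have "xs (Suc t) \<omega> - xtrue (Suc t) \<omega> =
          (?W *v F (xs t \<omega>) - ?W *v F (xtrue t \<omega>))
          + ?W *v (Fs (xs t \<omega>) - F (xs t \<omega>)) + \<gamma> *\<^sub>R (K *v \<eta> (Suc t) \<omega>)"
        by (simp add: x matrix_vector_mult_diff_distrib matrix_vector_mult_diff_rdistrib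
            matrix_vector_right_distrib matrix_vector_mul_assoc matrix_vector_mult_scaleR)
      then have "E (Suc t) \<omega> \<le> Nx (?W *v F (xs t \<omega>) - ?W *v F (xtrue t \<omega>))
          + Nx (?W *v (Fs (xs t \<omega>) - F (xs t \<omega>))) + Nx (\<gamma> *\<^sub>R (K *v \<eta> (Suc t) \<omega>))"
        unfolding E_def
        by (metis (no_types, lifting) add_right_mono is_norm_triangle[OF assms(1)] order_trans)
      also have "\<dots> \<le> lam * E t \<omega> + \<epsilon> + \<gamma> * (L * Ny (\<eta> (Suc t) \<omega>))"
        unfolding E_def using \<gamma>
        by (intro add_mono lip surr[rule_format])
          (auto simp: is_norm_scaleR[OF assms(1)] intro!: mult_left_mono L(2))
      finally show ?thesis
        by (simp add: mult_ac)
    qed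
    have "(\<integral>\<^sup>+\<omega>. ennreal (E (Suc t) \<omega>) \<partial>M)
        \<le> ennreal lam * (\<integral>\<^sup>+\<omega>. ennreal (E t \<omega>) \<partial>M) + ennreal (\<epsilon> + \<gamma> * L * A)" for t
    proof -
      have E0: "0 \<le> E t \<omega>" and N0: "0 \<le> Ny (\<eta> (Suc t) \<omega>)" for \<omega>
        unfolding E_def by (rule is_norm_nonneg[OF assms(1)], rule is_norm_nonneg[OF assms(2)])
      have "(\<integral>\<^sup>+\<omega>. ennreal (E (Suc t) \<omega>) \<partial>M)
          \<le> (\<integral>\<^sup>+\<omega>. ennreal lam * ennreal (E t \<omega>) + ennreal \<epsilon>
              + ennreal (\<gamma> * L) * ennreal (Ny (\<eta> (Suc t) \<omega>)) \<partial>M)"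
      proof (rule nn_integral_mono)
        fix \<omega> assume "\<omega> \<in> space M"
        then have "ennreal (E (Suc t) \<omega>)
            \<le> ennreal (lam * E t \<omega> + \<epsilon> + \<gamma> * L * Ny (\<eta> (Suc t) \<omega>))"
          by (intro ennreal_leI step)
        also have "\<dots> = ennreal lam * ennreal (E t \<omega>) + ennreal \<epsilon>
              + ennreal (\<gamma> * L) * ennreal (Ny (\<eta> (Suc t) \<omega>))"
          using lam \<epsilon> \<gamma> L(1) E0 N0 by (simp add: ennreal_mult ennreal_plus)
        finally show "ennreal (E (Suc t) \<omega>) \<le> \<dots>" .
      qed
      \<comment> \<open>Nonnegative integrals split by measurability alone, and total mass one
        leaves the constant \<open>\<epsilon>\<close> unchanged.\<close>
      also have "\<dots> = ennreal lam * (\<integral>\<^sup>+\<omega>. ennreal (E t \<omega>) \<partial>M) + ennreal \<epsilon>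
          + ennreal (\<gamma> * L) * (\<integral>\<^sup>+\<omega>. ennreal (Ny (\<eta> (Suc t) \<omega>)) \<partial>M)"
        using meas_E[of t] meas_N[of t]
        by (simp add: nn_integral_add nn_integral_cmult emeasure_space_1)
      also have "\<dots> \<le> ennreal lam * (\<integral>\<^sup>+\<omega>. ennreal (E t \<omega>) \<partial>M) + ennreal \<epsilon>
          + ennreal (\<gamma> * L) * ennreal A"
        using noise by (intro add_left_mono mult_left_mono) (auto intro: less_imp_le)
      also have "\<dots> = ennreal lam * (\<integral>\<^sup>+\<omega>. ennreal (E t \<omega>) \<partial>M) + ennreal (\<epsilon> + \<gamma> * L * A)"
        using \<epsilon> \<gamma> L(1) assms(7) by (simp add: ennreal_mult ennreal_plus add.assoc)
      finally show ?thesis .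
    qed
    then have "limsup (\<lambda>t. \<integral>\<^sup>+\<omega>. ennreal (E t \<omega>) \<partial>M) \<le> ennreal ((\<epsilon> + \<gamma> * L * A) / (1 - lam))"
      using lam \<epsilon> \<gamma> L(1) assms(7) fin
      by (intro contraction_recurrence_limsup_le) (auto simp: E_def)
    \<comment> \<open>The entry \<open>1\<close> of the maximum \<open>c\<close> absorbs the
      coefficient of \<open>\<epsilon>\<close>, and \<open>L * A\<close> that of
      \<open>\<gamma>\<close>.\<close>
    also have "\<epsilon> + \<gamma> * L * A \<le> c * (\<gamma> + \<epsilon>)"
      using mult_right_mono[of 1 c \<epsilon>] mult_left_mono[of "L * A" c \<gamma>] \<epsilon> \<gamma>
      by (simp add: c_def algebra_simps)
    then have "ennreal ((\<epsilon> + \<gamma> * L * A) / (1 - lam)) \<le> ennreal (c * ((\<gamma> + \<epsilon>) / (1 - lam)))"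
      using lam by (auto intro!: ennreal_leI divide_right_mono)
    finally show ?thesis
      by (simp add: E_def)
  qed
  ultimately show ?thesis
    by blast
qed

end
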